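(* Let $\sigma$ be a finite relational signature. The set $\mathrm{FMP}(\sigma)$ has the $(\tau_{\to},\mathsf{EPFO}[\sigma])$ preservation property: for every existential positive $\sigma$-sentence $\psi$, the set $\{A\in\mathrm{FMP}(\sigma)\mid A\models\psi\}$ is upwards-closed for $\to$ in $\mathrm{FMP}(\sigma)$; and for every first-order $\sigma$-sentence $\varphi$ such that $\{A\in\mathrm{FMP}(\sigma)\mid A\models\varphi\}$ is upwards-closed for $\to$ in $\mathrm{FMP}(\sigma)$, there is an existential positive $\sigma$-sentence $\psi$ such that for all $A\in\mathrm{FMP}(\sigma)$, $A\models\varphi$ if and only if $A\models\psi$.
   Context: $\sigma$ has no constant symbols, and equality is always available and interpreted as true equality. All $\sigma$-structures are assumed to have cardinality bounded by some fixed infinite cardinal, so that they form a set $\mathrm{Struct}(\sigma)$. $\mathrm{FMP}(\sigma)\subseteq\mathrm{Struct}(\sigma)$ is the set of structures $A$ whose first-order theory has the finite model property: every first-order $\sigma$-sentence true in $A$ has a finite model. $A\to B$ means there is a homomorphism from $A$ to $B$, i.e. a map $|A|\to|B|$ sending each tuple of $R^A$ to a tuple of $R^B$ for every relation symbol $R\in\sigma$. $\tau_\to$ is the Alexandroff topology of $\to$ on $\mathrm{FMP}(\sigma)$, whose open sets are the upwards-closed subsets. $\mathsf{EPFO}[\sigma]$ is the set of existential positive sentences, built from atoms (including equalities, and the constants $\top,\bot$) using $\wedge,\vee,\exists$. *)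

theory Defs
  imports "HOL-Analysis.Abstract_Topology"
begin

text \<open>Relational signatures carry an explicit set of symbols, so that the empty signature is
  included. Nullary symbols are allowed.\<close>

record 'r signature =
  symbols :: "'r set"
  arity :: "'r \<Rightarrow> nat"

record ('r, 'u) struct =
  univ :: "'u set"
  interp :: "'r \<Rightarrow> 'u list set"

text \<open>The structures whose universe is a nonempty subset of the type \<open>'u\<close>: up to isomorphism
  these are the structures of cardinality at most that of \<open>'u\<close>. The values of \<open>interp\<close> outside
  \<open>symbols \<sigma>\<close> are irrelevant.\<close>

definition Struct :: "'r signature \<Rightarrow> ('r, 'u) struct set" where
  "Struct \<sigma> = {A. univ A \<noteq> {} \<and>
     (\<forall>R\<in>symbols \<sigma>. interp A R \<subseteq> {xs. length xs = arity \<sigma> R \<and> set xs \<subseteq> univ A})}"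

definition homomorphism ::
    "'r signature \<Rightarrow> ('r, 'u) struct \<Rightarrow> ('r, 'u) struct \<Rightarrow> ('u \<Rightarrow> 'u) \<Rightarrow> bool" where
  "homomorphism \<sigma> A B h \<longleftrightarrow> h ` univ A \<subseteq> univ B \<and>
     (\<forall>R\<in>symbols \<sigma>. \<forall>xs\<in>interp A R. map h xs \<in> interp B R)"

definition hom_le :: "'r signature \<Rightarrow> ('r, 'u) struct \<Rightarrow> ('r, 'u) struct \<Rightarrow> bool" where
  "hom_le \<sigma> A B \<longleftrightarrow> (\<exists>h. homomorphism \<sigma> A B h)"

datatype 'r fm =
    Top
  | Bot
  | Eq nat nat
  | Rel 'r "nat list"
  | Neg "'r fm"
  | And "'r fm" "'r fm"
  | Or "'r fm" "'r fm"
  | Exists nat "'r fm"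
  | Forall nat "'r fm"

primrec free_vars :: "'r fm \<Rightarrow> nat set" where
  "free_vars Top = {}"
| "free_vars Bot = {}"
| "free_vars (Eq x y) = {x, y}"
| "free_vars (Rel R xs) = set xs"
| "free_vars (Neg \<phi>) = free_vars \<phi>"
| "free_vars (And \<phi> \<psi>) = free_vars \<phi> \<union> free_vars \<psi>"
| "free_vars (Or \<phi> \<psi>) = free_vars \<phi> \<union> free_vars \<psi>"
| "free_vars (Exists x \<phi>) = free_vars \<phi> - {x}"
| "free_vars (Forall x \<phi>) = free_vars \<phi> - {x}"

primrec wf_fm :: "'r signature \<Rightarrow> 'r fm \<Rightarrow> bool" where
  "wf_fm \<sigma> Top \<longleftrightarrow> True"
| "wf_fm \<sigma> Bot \<longleftrightarrow> True"
| "wf_fm \<sigma> (Eq x y) \<longleftrightarrow> True"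
| "wf_fm \<sigma> (Rel R xs) \<longleftrightarrow> R \<in> symbols \<sigma> \<and> length xs = arity \<sigma> R"
| "wf_fm \<sigma> (Neg \<phi>) \<longleftrightarrow> wf_fm \<sigma> \<phi>"
| "wf_fm \<sigma> (And \<phi> \<psi>) \<longleftrightarrow> wf_fm \<sigma> \<phi> \<and> wf_fm \<sigma> \<psi>"
| "wf_fm \<sigma> (Or \<phi> \<psi>) \<longleftrightarrow> wf_fm \<sigma> \<phi> \<and> wf_fm \<sigma> \<psi>"
| "wf_fm \<sigma> (Exists x \<phi>) \<longleftrightarrow> wf_fm \<sigma> \<phi>"
| "wf_fm \<sigma> (Forall x \<phi>) \<longleftrightarrow> wf_fm \<sigma> \<phi>"

primrec existential_positive :: "'r fm \<Rightarrow> bool" where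
  "existential_positive Top \<longleftrightarrow> True"
| "existential_positive Bot \<longleftrightarrow> True"
| "existential_positive (Eq x y) \<longleftrightarrow> True"
| "existential_positive (Rel R xs) \<longleftrightarrow> True"
| "existential_positive (Neg \<phi>) \<longleftrightarrow> False"
| "existential_positive (And \<phi> \<psi>) \<longleftrightarrow> existential_positive \<phi> \<and> existential_positive \<psi>"
| "existential_positive (Or \<phi> \<psi>) \<longleftrightarrow> existential_positive \<phi> \<and> existential_positive \<psi>"
| "existential_positive (Exists x \<phi>) \<longleftrightarrow> existential_positive \<phi>"
| "existential_positive (Forall x \<phi>) \<longleftrightarrow> False"

primrec sat :: "('r, 'u) struct \<Rightarrow> (nat \<Rightarrow> 'u) \<Rightarrow> 'r fm \<Rightarrow> bool" where
  "sat A v Top \<longleftrightarrow> True"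
| "sat A v Bot \<longleftrightarrow> False"
| "sat A v (Eq x y) \<longleftrightarrow> v x = v y"
| "sat A v (Rel R xs) \<longleftrightarrow> map v xs \<in> interp A R"
| "sat A v (Neg \<phi>) \<longleftrightarrow> \<not> sat A v \<phi>"
| "sat A v (And \<phi> \<psi>) \<longleftrightarrow> sat A v \<phi> \<and> sat A v \<psi>"
| "sat A v (Or \<phi> \<psi>) \<longleftrightarrow> sat A v \<phi> \<or> sat A v \<psi>"
| "sat A v (Exists x \<phi>) \<longleftrightarrow> (\<exists>a\<in>univ A. sat A (v(x := a)) \<phi>)"
| "sat A v (Forall x \<phi>) \<longleftrightarrow> (\<forall>a\<in>univ A. sat A (v(x := a)) \<phi>)"

text \<open>Only used for sentences, where the valuation plays no role.\<close>

definition models :: "('r, 'u) struct \<Rightarrow> 'r fm \<Rightarrow> bool" (infix "\<Turnstile>" 50) where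
  "A \<Turnstile> \<phi> \<longleftrightarrow> (\<forall>v. range v \<subseteq> univ A \<longrightarrow> sat A v \<phi>)"

definition FO :: "'r signature \<Rightarrow> 'r fm set" where
  "FO \<sigma> = {\<phi>. wf_fm \<sigma> \<phi> \<and> free_vars \<phi> = {}}"

definition EPFO :: "'r signature \<Rightarrow> 'r fm set" where
  "EPFO \<sigma> = {\<phi> \<in> FO \<sigma>. existential_positive \<phi>}"

text \<open>When \<open>'u\<close> is infinite, every finite structure has an isomorphic copy in
  \<open>Struct \<sigma>\<close>, so it is no restriction to look for the finite model \<open>B\<close> there.\<close>

definition FMP :: "'r signature \<Rightarrow> ('r, 'u) struct set" where
  "FMP \<sigma> = {A \<in> Struct \<sigma>. \<forall>\<phi>\<in>FO \<sigma>. A \<Turnstile> \<phi> \<longrightarrow>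
     (\<exists>B\<in>(Struct \<sigma> :: ('r, 'u) struct set). finite (univ B) \<and> B \<Turnstile> \<phi>)}"

definition upwards_closed_in :: "'a set \<Rightarrow> ('a \<Rightarrow> 'a \<Rightarrow> bool) \<Rightarrow> 'a set \<Rightarrow> bool" where
  "upwards_closed_in X r U \<longleftrightarrow> U \<subseteq> X \<and> (\<forall>a\<in>U. \<forall>b\<in>X. r a b \<longrightarrow> b \<in> U)"

definition alexandroff_topology :: "'a set \<Rightarrow> ('a \<Rightarrow> 'a \<Rightarrow> bool) \<Rightarrow> 'a topology" where
  "alexandroff_topology X r = topology (upwards_closed_in X r)"

lemma openin_alexandroff_topology:
  "openin (alexandroff_topology X r) U \<longleftrightarrow> upwards_closed_in X r U"
proof -
  have "istopology (upwards_closed_in X r)"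
    unfolding istopology_def upwards_closed_in_def by blast
  then show ?thesis
    by (simp add: alexandroff_topology_def topology_inverse')
qed

definition preservation_property ::
    "'r signature \<Rightarrow> ('r, 'u) struct set \<Rightarrow> ('r, 'u) struct topology \<Rightarrow> 'r fm set \<Rightarrow> bool" where
  "preservation_property \<sigma> X \<tau> F \<longleftrightarrow>
     (\<forall>\<psi>\<in>F. openin \<tau> {A\<in>X. A \<Turnstile> \<psi>}) \<and>
     (\<forall>\<phi>\<in>FO \<sigma>. openin \<tau> {A\<in>X. A \<Turnstile> \<phi>} \<longrightarrow>
        (\<exists>\<psi>\<in>F. \<forall>A\<in>X. A \<Turnstile> \<phi> \<longleftrightarrow> A \<Turnstile> \<psi>))"

end

theory Submission
  imports Defs "HOL-Library.Countable_Set"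
begin

text \<open>Upward closure is assumed on all of \<open>FMP\<close>, infinite structures included, so the classical
  model-theoretic argument applies. If \<open>\<phi>\<close> is equivalent to no existential positive sentence, then
  for every finite set \<open>T\<close> of such sentences there are finite structures \<open>A \<Turnstile> \<phi>\<close> and \<open>B \<Turnstile> \<not>\<phi>\<close> such
  that \<open>B\<close> satisfies every member of \<open>T\<close> true in \<open>A\<close>; otherwise \<open>\<phi>\<close> would be a disjunction of
  conjunctions of members of \<open>T\<close>. Let \<open>T\<close> exhaust the countably many existential positive sentences
  and take ultraproducts of the resulting sequences along a nonprincipal ultrafilter. These are
  limits of finite structures, hence have the finite model property, and countable saturation maps a
  countable elementary submodel of the first homomorphically into one of the second. Countable
  structures embed into \<open>'u\<close>, so this contradicts upward closure.\<close>

section \<open>Formulas\<close>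

instance fm :: (countable) countable
  by countable_datatype

lemma wf_fm_set_fm: "wf_fm \<sigma> \<phi> \<Longrightarrow> set_fm \<phi> \<subseteq> symbols \<sigma>"
  by (induction \<phi>) auto

text \<open>The type \<open>'r\<close> may be uncountable. Renaming symbols by
  \<open>to_nat_on\<close> is injective on \<open>symbols \<sigma>\<close>, hence on formulas over
  \<open>\<sigma>\<close>, and lands in the countable type of formulas over
  \<open>nat\<close>.\<close>

lemma countable_wf_fm:
  assumes "countable (symbols \<sigma>)"
  shows "countable {\<phi>. wf_fm \<sigma> \<phi>}"
proof (rule countableI)
  have "inj_on (map_fm (to_nat_on (symbols \<sigma>))) {\<phi>. wf_fm \<sigma> \<phi>}"
  proof (rule inj_onI, rule fm.inj_map_strong)
    fix \<phi> \<psi> z w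
    assume "\<phi> \<in> {\<phi>. wf_fm \<sigma> \<phi>}" "\<psi> \<in> {\<phi>. wf_fm \<sigma> \<phi>}" "z \<in> set_fm \<phi>" "w \<in> set_fm \<psi>"
      "to_nat_on (symbols \<sigma>) z = to_nat_on (symbols \<sigma>) w"
    moreover from this have "z \<in> symbols \<sigma>" "w \<in> symbols \<sigma>"
      using wf_fm_set_fm[of \<sigma>] by blast+
    ultimately show "z = w"
      using inj_onD[OF inj_on_to_nat_on[OF assms]] by blast
  qed auto
  from comp_inj_on[OF this inj_on_subset[OF inj_to_nat subset_UNIV]]
  show "inj_on (to_nat \<circ> map_fm (to_nat_on (symbols \<sigma>))) {\<phi>. wf_fm \<sigma> \<phi>}" .
qed

section \<open>Sentences, valuations and finite Boolean combinations\<close>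

lemma finite_free_vars: "finite (free_vars \<phi>)"
  by (induction \<phi>) auto

lemma sat_cong: "(\<And>k. k \<in> free_vars \<phi> \<Longrightarrow> v k = w k) \<Longrightarrow> sat A v \<phi> \<longleftrightarrow> sat A w \<phi>"
proof (induction \<phi> arbitrary: v w)
  case (Rel R xs)
  then have "map v xs = map w xs"
    by simp
  then show ?case
    by (simp only: sat.simps)
next
  case (Neg \<phi>)
  have "sat A v \<phi> \<longleftrightarrow> sat A w \<phi>"
    using Neg.prems by (intro Neg.IH) auto
  then show ?case by simp
next
  case (And \<phi> \<psi>)
  have "sat A v \<phi> \<longleftrightarrow> sat A w \<phi>" "sat A v \<psi> \<longleftrightarrow> sat A w \<psi>"
    using And.prems by (intro And.IH; simp)+
  then show ?case by simp
next
  case (Or \<phi> \<psi>)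
  have "sat A v \<phi> \<longleftrightarrow> sat A w \<phi>" "sat A v \<psi> \<longleftrightarrow> sat A w \<psi>"
    using Or.prems by (intro Or.IH; simp)+
  then show ?case by simp
next
  case (Exists x \<phi>)
  have "sat A (v(x := a)) \<phi> \<longleftrightarrow> sat A (w(x := a)) \<phi>" for a
    using Exists.prems by (intro Exists.IH) auto
  then show ?case by simp
next
  case (Forall x \<phi>)
  have "sat A (v(x := a)) \<phi> \<longleftrightarrow> sat A (w(x := a)) \<phi>" for a
    using Forall.prems by (intro Forall.IH) auto
  then show ?case by simp
qed auto

lemma models_iff_sat:
  assumes "free_vars \<phi> = {}" "range v \<subseteq> univ A"
  shows "A \<Turnstile> \<phi> \<longleftrightarrow> sat A v \<phi>"
proof -
  have "sat A w \<phi> \<longleftrightarrow> sat A v \<phi>" for w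
    using assms(1) by (intro sat_cong) simp
  then show ?thesis
    using assms(2) by (auto simp: models_def)
qed

lemma models_sentence:
  assumes "A \<in> Struct \<sigma>"
  shows "\<exists>v. range v \<subseteq> univ A \<and> (\<forall>\<phi>\<in>FO \<sigma>. A \<Turnstile> \<phi> \<longleftrightarrow> sat A v \<phi>)"
proof -
  obtain a where "a \<in> univ A"
    using assms by (auto simp: Struct_def)
  then have v: "range (\<lambda>_. a) \<subseteq> univ A"
    by auto
  then have "A \<Turnstile> \<phi> \<longleftrightarrow> sat A (\<lambda>_. a) \<phi>" if "\<phi> \<in> FO \<sigma>" for \<phi>
    using that by (intro models_iff_sat) (simp_all add: FO_def)
  with v show ?thesis by blast
qed

text \<open>One valuation decides all sentences at once. For open formulas the clauses for
  \<open>Neg\<close> and \<open>Or\<close> can fail, since \<open>\<Turnstile>\<close> quantifies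
  over all valuations.\<close>

lemma models_connectives:
  assumes "A \<in> Struct \<sigma>" "\<phi> \<in> FO \<sigma>" "\<psi> \<in> FO \<sigma>"
  shows "A \<Turnstile> Neg \<phi> \<longleftrightarrow> \<not> A \<Turnstile> \<phi>"
    and "A \<Turnstile> And \<phi> \<psi> \<longleftrightarrow> A \<Turnstile> \<phi> \<and> A \<Turnstile> \<psi>"
    and "A \<Turnstile> Or \<phi> \<psi> \<longleftrightarrow> A \<Turnstile> \<phi> \<or> A \<Turnstile> \<psi>"
proof -
  obtain v where v: "\<forall>\<phi>\<in>FO \<sigma>. A \<Turnstile> \<phi> \<longleftrightarrow> sat A v \<phi>"
    using models_sentence[OF assms(1)] by blast
  have "Neg \<phi> \<in> FO \<sigma>" "And \<phi> \<psi> \<in> FO \<sigma>" "Or \<phi> \<psi> \<in> FO \<sigma>"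
    using assms(2,3) by (auto simp: FO_def)
  then show "A \<Turnstile> Neg \<phi> \<longleftrightarrow> \<not> A \<Turnstile> \<phi>"
    and "A \<Turnstile> And \<phi> \<psi> \<longleftrightarrow> A \<Turnstile> \<phi> \<and> A \<Turnstile> \<psi>"
    and "A \<Turnstile> Or \<phi> \<psi> \<longleftrightarrow> A \<Turnstile> \<phi> \<or> A \<Turnstile> \<psi>"
    using assms(2,3) by (simp_all add: bspec[OF v])
qed

lemma finite_conj_EPFO:
  assumes "finite S" "S \<subseteq> EPFO \<sigma>"
  shows "\<exists>\<psi>\<in>EPFO \<sigma>. \<forall>A\<in>Struct \<sigma> :: ('r, 'u) struct set. A \<Turnstile> \<psi> \<longleftrightarrow> (\<forall>\<chi>\<in>S. A \<Turnstile> \<chi>)"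
  using assms
proof (induction S)
  case empty
  show ?case
    by (intro bexI[of _ Top]) (auto simp: EPFO_def FO_def models_def)
next
  case (insert \<chi> S)
  then obtain \<psi> where \<psi>: "\<psi> \<in> EPFO \<sigma>"
    "\<forall>A\<in>Struct \<sigma> :: ('r, 'u) struct set. A \<Turnstile> \<psi> \<longleftrightarrow> (\<forall>\<chi>\<in>S. A \<Turnstile> \<chi>)"
    by blast
  have "And \<chi> \<psi> \<in> EPFO \<sigma>" "\<chi> \<in> FO \<sigma>" "\<psi> \<in> FO \<sigma>"
    using insert.prems \<psi>(1) by (auto simp: EPFO_def FO_def)
  then show ?case
    using \<psi>(2) by (intro bexI[of _ "And \<chi> \<psi>"]) (simp_all add: models_connectives[where \<sigma> = \<sigma>])
qed

lemma finite_disj_EPFO: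
  assumes "finite S" "S \<subseteq> EPFO \<sigma>"
  shows "\<exists>\<psi>\<in>EPFO \<sigma>. \<forall>A\<in>Struct \<sigma> :: ('r, 'u) struct set. A \<Turnstile> \<psi> \<longleftrightarrow> (\<exists>\<chi>\<in>S. A \<Turnstile> \<chi>)"
  using assms
proof (induction S)
  case empty
  \<comment> \<open>A nonempty universe admits a valuation, and any valuation refutes
    \<open>Bot\<close>.\<close>
  have "\<not> A \<Turnstile> Bot" if "A \<in> Struct \<sigma>" for A :: "('r, 'u) struct"
    using models_sentence[OF that] by (auto simp: models_def)
  then show ?case
    by (intro bexI[of _ Bot]) (auto simp: EPFO_def FO_def)
next
  case (insert \<chi> S)
  then obtain \<psi> where \<psi>: "\<psi> \<in> EPFO \<sigma>"
    "\<forall>A\<in>Struct \<sigma> :: ('r, 'u) struct set. A \<Turnstile> \<psi> \<longleftrightarrow> (\<exists>\<chi>\<in>S. A \<Turnstile> \<chi>)"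
    by blast
  have "Or \<chi> \<psi> \<in> EPFO \<sigma>" "\<chi> \<in> FO \<sigma>" "\<psi> \<in> FO \<sigma>"
    using insert.prems \<psi>(1) by (auto simp: EPFO_def FO_def)
  then show ?case
    using \<psi>(2) by (intro bexI[of _ "Or \<chi> \<psi>"]) (simp_all add: models_connectives[where \<sigma> = \<sigma>])
qed

section \<open>Preservation of existential positive sentences under homomorphisms\<close>

lemma existential_positive_hom:
  assumes "homomorphism \<sigma> A B h"
  shows "existential_positive \<psi> \<Longrightarrow> wf_fm \<sigma> \<psi> \<Longrightarrow> range v \<subseteq> univ A \<Longrightarrow>
    sat A v \<psi> \<Longrightarrow> sat B (h \<circ> v) \<psi>"
proof (induction \<psi> arbitrary: v)
  case (Rel R xs)
  then have "map h (map v xs) \<in> interp B R"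
    using assms by (simp add: homomorphism_def del: map_map)
  then show ?case by (simp add: comp_def)
next
  case (Exists x \<psi>)
  then obtain a where a: "a \<in> univ A" "sat A (v(x := a)) \<psi>"
    by auto
  have "range (v(x := a)) \<subseteq> univ A"
    using a Exists.prems by auto
  then have "sat B (h \<circ> v(x := a)) \<psi>"
    using Exists.prems(1,2) a(2) by (intro Exists.IH) (simp_all del: fun_upd_apply)
  then have "sat B ((h \<circ> v)(x := h a)) \<psi>"
    by (simp add: fun_upd_comp)
  moreover have "h a \<in> univ B"
    using a(1) assms by (auto simp: homomorphism_def)
  ultimately show ?case
    unfolding sat.simps by blast
qed auto

lemma EPFO_hom_le:
  assumes "\<psi> \<in> EPFO \<sigma>" "A \<in> Struct \<sigma>" "hom_le \<sigma> A B" "A \<Turnstile> \<psi>"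
  shows "B \<Turnstile> \<psi>"
proof -
  obtain h where h: "homomorphism \<sigma> A B h"
    using assms by (auto simp: hom_le_def)
  have \<psi>: "\<psi> \<in> FO \<sigma>"
    using assms(1) by (simp add: EPFO_def)
  obtain v where v: "range v \<subseteq> univ A" "\<forall>\<phi>\<in>FO \<sigma>. A \<Turnstile> \<phi> \<longleftrightarrow> sat A v \<phi>"
    using models_sentence[OF assms(2)] by blast
  have "sat B (h \<circ> v) \<psi>"
    using existential_positive_hom[OF h _ _ v(1)] v(2) \<psi> assms(1,4)
    by (simp add: EPFO_def FO_def)
  moreover have "range (h \<circ> v) \<subseteq> univ B"
    using h v by (auto simp: homomorphism_def)
  ultimately show ?thesis
    using \<psi> models_iff_sat[of \<psi> "h \<circ> v" B] by (simp add: FO_def)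
qed

section \<open>Existential positive sentences describing finite sets of atoms\<close>

lemma sat_conj: "sat A v (foldr And \<phi>s Top) \<longleftrightarrow> (\<forall>\<phi>\<in>set \<phi>s. sat A v \<phi>)"
  by (induction \<phi>s) auto

lemma sat_foldr_Exists:
  "sat A v (foldr Exists xs \<phi>) \<longleftrightarrow>
    (\<exists>w. (\<forall>k\<in>set xs. w k \<in> univ A) \<and> (\<forall>k. k \<notin> set xs \<longrightarrow> w k = v k) \<and> sat A w \<phi>)"
proof (induction xs arbitrary: v)
  case Nil
  have "w = v" if "\<forall>k. w k = v k" for w
    using that by auto
  then show ?case by auto
next
  case (Cons x xs)
  show ?case (is "?l \<longleftrightarrow> ?r")
  proof
    assume ?l
    then show ?r
      by (auto simp: Cons.IH) metis
  next
    assume ?r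
    then obtain w where w: "\<forall>k\<in>set (x # xs). w k \<in> univ A"
        "\<forall>k. k \<notin> set (x # xs) \<longrightarrow> w k = v k" "sat A w \<phi>"
      by auto
    then show ?l
      by (auto simp: Cons.IH intro!: bexI[of _ "w x"] exI[of _ w])
  qed
qed

text \<open>The sentence is the canonical conjunctive query of \<open>\<Delta>\<close>: the
  conjunction of its atoms with all variables existentially quantified. It expresses that a finite
  piece of a positive diagram is realised in \<open>A\<close>.\<close>

lemma atoms_EPFO:
  fixes \<Delta> :: "('r \<times> nat list) set"
  assumes "finite \<Delta>"
    and "\<And>R ks. (R, ks) \<in> \<Delta> \<Longrightarrow> R \<in> symbols \<sigma> \<and> length ks = arity \<sigma> R"
  shows "\<exists>\<psi>\<in>EPFO \<sigma>. \<forall>A\<in>Struct \<sigma> :: ('r, 'u) struct set. A \<Turnstile> \<psi> \<longleftrightarrow>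
      (\<exists>w. range w \<subseteq> univ A \<and> (\<forall>(R, ks)\<in>\<Delta>. map w ks \<in> interp A R))"
proof -
  obtain \<delta> where \<delta>: "set \<delta> = \<Delta>"
    using assms(1) finite_list by auto
  define \<phi> where "\<phi> = foldr And (map (\<lambda>(R, ks). Rel R ks) \<delta>) Top"
  obtain xs where xs: "set xs = free_vars \<phi>"
    using finite_free_vars finite_list by metis
  define \<psi> where "\<psi> = foldr Exists xs \<phi>"
  have "existential_positive (foldr And (map (\<lambda>(R, ks). Rel R ks) \<delta>) Top)"
    for \<delta> :: "('r \<times> nat list) list"
    by (induction \<delta>) auto
  moreover have "(\<forall>(R, ks)\<in>set \<delta>. R \<in> symbols \<sigma> \<and> length ks = arity \<sigma> R) \<Longrightarrow>
      wf_fm \<sigma> (foldr And (map (\<lambda>(R, ks). Rel R ks) \<delta>) Top)" for \<delta>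
    by (induction \<delta>) auto
  ultimately have \<phi>: "existential_positive \<phi>" "wf_fm \<sigma> \<phi>"
    using assms(2) \<delta> by (auto simp: \<phi>_def)
  have "existential_positive (foldr Exists xs \<phi>) \<and> wf_fm \<sigma> (foldr Exists xs \<phi>) \<and>
      free_vars (foldr Exists xs \<phi>) = free_vars \<phi> - set xs" for xs
    using \<phi> by (induction xs) auto
  then have \<psi>: "\<psi> \<in> EPFO \<sigma>"
    by (auto simp: \<psi>_def EPFO_def FO_def xs)
  have "A \<Turnstile> \<psi> \<longleftrightarrow> (\<exists>w. range w \<subseteq> univ A \<and> (\<forall>(R, ks)\<in>\<Delta>. map w ks \<in> interp A R))"
    if A: "A \<in> Struct \<sigma>" for A :: "('r, 'u) struct"
  proof -
    obtain v where v: "range v \<subseteq> univ A" "\<forall>\<phi>\<in>FO \<sigma>. A \<Turnstile> \<phi> \<longleftrightarrow> sat A v \<phi>"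
      using models_sentence[OF A] by blast
    have "sat A v \<psi> \<longleftrightarrow> (\<exists>w. range w \<subseteq> univ A \<and> sat A w \<phi>)"
    proof
      assume "sat A v \<psi>"
      then obtain w where w: "\<forall>k\<in>set xs. w k \<in> univ A" "\<forall>k. k \<notin> set xs \<longrightarrow> w k = v k" "sat A w \<phi>"
        by (auto simp: \<psi>_def sat_foldr_Exists)
      then have "w k \<in> univ A" for k
        using v(1) by (cases "k \<in> set xs") auto
      then show "\<exists>w. range w \<subseteq> univ A \<and> sat A w \<phi>"
        using w by blast
    next
      assume "\<exists>w. range w \<subseteq> univ A \<and> sat A w \<phi>"
      then obtain w where w: "range w \<subseteq> univ A" "sat A w \<phi>" by blast
      \<comment> \<open>The free variables of \<open>\<phi>\<close> all lie in \<open>xs\<close>, so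
        \<open>w\<close> may be replaced by \<open>v\<close> elsewhere, as the quantifier prefix
        requires.\<close>
      have "sat A (\<lambda>k. if k \<in> set xs then w k else v k) \<phi>"
        using w(2) by (subst sat_cong[of \<phi> _ w]) (simp_all add: xs)
      then show "sat A v \<psi>"
        using w(1) unfolding \<psi>_def sat_foldr_Exists by (intro exI conjI) auto
    qed
    moreover have "sat A w \<phi> \<longleftrightarrow> (\<forall>(R, ks)\<in>\<Delta>. map w ks \<in> interp A R)" for w
      by (auto simp: \<phi>_def sat_conj \<delta>)
    ultimately show ?thesis
      using v(2) \<psi> by (simp add: EPFO_def)
  qed
  with \<psi> show ?thesis by blast
qed

section \<open>Countable elementary submodels of ultraproducts\<close>

text \<open>Smaller filters are finer, so an ultrafilter is a minimal proper filter, and Zorn's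
  lemma is applied to the reversed order.\<close>

lemma ultrafilter_extension:
  assumes "F \<noteq> bot"
  obtains U where "U \<le> F" "U \<noteq> bot"
    and "\<And>P. eventually P U \<or> eventually (\<lambda>x. \<not> P x) U"
proof -
  let ?S = "{G. G \<le> F \<and> G \<noteq> bot}"
  have "\<exists>U\<in>?S. \<forall>G\<in>?S. G \<le> U \<longrightarrow> G = U"
  proof (rule predicate_Zorn)
    show "partial_order_on ?S (relation_of (\<lambda>G H. H \<le> G) ?S)"
      by (rule partial_order_on_relation_ofI) auto
  next
    fix C assume C: "C \<in> Chains (relation_of (\<lambda>G H. H \<le> G) ?S)"
    show "\<exists>u\<in>?S. \<forall>a\<in>C. u \<le> a"
    proof (cases "C = {}")
      case True
      then show ?thesis using assms by auto
    next
      case False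
      have sub: "C \<subseteq> ?S" and tot: "\<And>G H. G \<in> C \<Longrightarrow> H \<in> C \<Longrightarrow> G \<le> H \<or> H \<le> G"
        using C by (auto simp: Chains_def relation_of_def)
      have "\<exists>x\<in>C. x \<le> inf G H" if "G \<in> C" "H \<in> C" for G H
      proof -
        have "G \<le> inf G H \<or> H \<le> inf G H"
          using tot[OF that] by auto
        then show ?thesis
          using that by blast
      qed
      \<comment> \<open>A chain is directed downwards, so \<open>Inf C\<close> could be improper
        only if some member of \<open>C\<close> were.\<close>
      then have "eventually (\<lambda>_. False) (Inf C) \<longleftrightarrow> (\<exists>G\<in>C. eventually (\<lambda>_. False) G)"
        using False by (subst eventually_Inf_base) auto
      then have "Inf C \<noteq> bot"
        using sub by (auto simp: trivial_limit_def)
      moreover obtain G where "G \<in> C" "G \<le> F"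
        using sub False by blast
      then have "Inf C \<le> F"
        by (rule Inf_lower2)
      ultimately show ?thesis
        by (intro bexI[of _ "Inf C"]) (auto intro: Inf_lower)
    qed
  qed
  then obtain U where U: "U \<le> F" "U \<noteq> bot"
    and min: "\<And>G. G \<le> F \<Longrightarrow> G \<noteq> bot \<Longrightarrow> G \<le> U \<Longrightarrow> G = U"
    by blast
  \<comment> \<open>If adding \<open>P\<close> to \<open>U\<close> gives the improper filter, the
    complement of \<open>P\<close> already belongs to \<open>U\<close>; otherwise minimality shows
    that adding \<open>P\<close> changes nothing.\<close>
  have "eventually P U \<or> eventually (\<lambda>x. \<not> P x) U" for P
  proof (cases "inf U (principal {x. P x}) = bot")
    case True
    then show ?thesis
      by (simp add: trivial_limit_def eventually_inf_principal)
  next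
    case False
    then have "inf U (principal {x. P x}) = U"
      using U by (intro min) (auto intro: le_infI1)
    moreover have "eventually P (inf U (principal {x. P x}))"
      by (simp add: eventually_inf_principal)
    ultimately show ?thesis by simp
  qed
  with U show ?thesis using that by blast
qed

text \<open>Closing \<open>G\<close> under coordinatewise Skolem functions gives the Tarski-Vaught
  condition for the classes of \<open>F\<close> in any ultraproduct: one \<open>g\<close> supplies
  witnesses in all coordinates where they exist. Formulas and finite parameter lists are countable
  in number, so \<open>F\<close> stays countable.\<close>

lemma countable_skolem_closure:
  fixes A :: "'i \<Rightarrow> ('r, 'u) struct"
  assumes A: "\<And>m. univ (A m) \<noteq> {}"
    and \<sigma>: "countable (symbols \<sigma>)"
    and G: "countable G" "\<And>g m. g \<in> G \<Longrightarrow> g m \<in> univ (A m)"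
  obtains F where "countable F" "G \<subseteq> F" "F \<noteq> {}" "\<And>f m. f \<in> F \<Longrightarrow> f m \<in> univ (A m)"
    and "\<And>\<phi> x v. wf_fm \<sigma> \<phi> \<Longrightarrow> range v \<subseteq> F \<Longrightarrow>
      \<exists>g\<in>F. \<forall>m. sat (A m) (\<lambda>k. v k m) (Exists x \<phi>) \<longrightarrow> sat (A m) ((\<lambda>k. v k m)(x := g m)) \<phi>"
proof -
  define d where "d = (\<lambda>m. SOME a. a \<in> univ (A m))"
  have d: "d m \<in> univ (A m)" for m
    using A[of m] by (auto simp: d_def some_in_eq)
  \<comment> \<open>A finite list of parameters is padded by the default \<open>d\<close>, so that
    Skolem functions take lists instead of the uncountably many possible valuations.\<close>
  define val where "val = (\<lambda>fs m k. if k < length fs then (fs ! k) m else d m)"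
  define sk where "sk = (\<lambda>\<phi> x fs m. if sat (A m) (val fs m) (Exists x \<phi>)
    then SOME a. a \<in> univ (A m) \<and> sat (A m) ((val fs m)(x := a)) \<phi> else d m)"
  have sk: "sk \<phi> x fs m \<in> univ (A m) \<and>
      (sat (A m) (val fs m) (Exists x \<phi>) \<longrightarrow> sat (A m) ((val fs m)(x := sk \<phi> x fs m)) \<phi>)"
    for \<phi> x fs m
  proof (cases "sat (A m) (val fs m) (Exists x \<phi>)")
    case True
    then have "\<exists>a. a \<in> univ (A m) \<and> sat (A m) ((val fs m)(x := a)) \<phi>"
      by auto
    from someI_ex[OF this] show ?thesis
      using True by (simp add: sk_def)
  qed (simp add: sk_def d)
  define step where "step = (\<lambda>F. F \<union> (\<lambda>(\<phi>, x, fs). sk \<phi> x fs) ` ({\<phi>. wf_fm \<sigma> \<phi>} \<times> UNIV \<times> lists F))"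
  \<comment> \<open>Starting from \<open>insert d G\<close> keeps \<open>F\<close> nonempty even
    when \<open>G\<close> is empty.\<close>
  define H where "H = (\<lambda>n. (step ^^ n) (insert d G))"
  define F where "F = (\<Union>n. H n)"
  have H0: "H 0 = insert d G" and HS: "H (Suc n) = step (H n)" for n
    by (auto simp: H_def)
  have "mono H"
    by (intro incseq_SucI) (auto simp: HS step_def)
  have "countable (H n)" for n
    by (induction n) (auto simp: H0 HS step_def G countable_wf_fm[OF \<sigma>])
  then have "countable F"
    by (simp add: F_def)
  moreover have "insert d G \<subseteq> F"
    unfolding F_def H0[symmetric] by auto
  moreover have "\<forall>f\<in>H n. \<forall>m. f m \<in> univ (A m)" for n
    by (induction n) (auto simp: H0 HS step_def G d sk)
  then have "f m \<in> univ (A m)" if "f \<in> F" for f m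
    using that by (auto simp: F_def)
  moreover have "\<exists>g\<in>F. \<forall>m. sat (A m) (\<lambda>k. v k m) (Exists x \<phi>) \<longrightarrow>
      sat (A m) ((\<lambda>k. v k m)(x := g m)) \<phi>"
    if \<phi>: "wf_fm \<sigma> \<phi>" and v: "range v \<subseteq> F" for \<phi> x v
  proof -
    obtain N where N: "\<And>k. k \<in> free_vars \<phi> \<Longrightarrow> k < N"
      using finite_nat_bounded[OF finite_free_vars] by blast
    define fs where "fs = map v [0..<N]"
    \<comment> \<open>The parameters may enter at different stages; being finitely many, they share
      one.\<close>
    have "\<exists>n. set (map v [0..<j]) \<subseteq> H n" for j
    proof (induction j)
      case (Suc j)
      then obtain n where "set (map v [0..<j]) \<subseteq> H n" by blast
      moreover obtain n' where "v j \<in> H n'"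
        using v by (auto simp: F_def)
      ultimately have "set (map v [0..<Suc j]) \<subseteq> H (max n n')"
        using monoD[OF \<open>mono H\<close>, of n "max n n'"] monoD[OF \<open>mono H\<close>, of n' "max n n'"] by auto
      then show ?case by blast
    qed auto
    then obtain n where n: "set fs \<subseteq> H n"
      unfolding fs_def by blast
    then have "sk \<phi> x fs \<in> H (Suc n)"
      using \<phi> by (force simp: HS step_def)
    then have "sk \<phi> x fs \<in> F"
      by (auto simp: F_def)
    moreover have "sat (A m) ((val fs m)(x := a)) \<phi> \<longleftrightarrow> sat (A m) ((\<lambda>k. v k m)(x := a)) \<phi>" for m a
      using N by (intro sat_cong) (auto simp: val_def fs_def)
    ultimately show ?thesis
      using sk[of \<phi> x fs] by (intro bexI[of _ "sk \<phi> x fs"]) auto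
  qed
  ultimately show ?thesis
    by (intro that[of F]) auto
qed

text \<open>\<open>M\<close> is a copy inside \<open>'u\<close> of the elementary submodel of the ultraproduct of \<open>A\<close> along
  \<open>U\<close> formed by the classes of the sequences in \<open>F\<close>; the class of \<open>f\<close> is coded by \<open>e f\<close>.\<close>

definition ultralimit ::
    "'r signature \<Rightarrow> nat filter \<Rightarrow> (nat \<Rightarrow> ('r, 'u) struct) \<Rightarrow> (nat \<Rightarrow> 'u) set \<Rightarrow>
      ((nat \<Rightarrow> 'u) \<Rightarrow> 'u) \<Rightarrow> ('r, 'u) struct \<Rightarrow> bool" where
  "ultralimit \<sigma> U A F e M \<longleftrightarrow> countable F \<and> F \<noteq> {} \<and> (\<forall>f\<in>F. \<forall>m. f m \<in> univ (A m)) \<and>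
     M \<in> Struct \<sigma> \<and> univ M = e ` F \<and>
     (\<forall>\<phi> v. wf_fm \<sigma> \<phi> \<longrightarrow> range v \<subseteq> F \<longrightarrow>
       (sat M (e \<circ> v) \<phi> \<longleftrightarrow> (\<forall>\<^sub>F m in U. sat (A m) (\<lambda>k. v k m) \<phi>)))"

text \<open>This is Los's theorem, by induction on formulas, for sequences closed under Skolem
  choices. Countability of \<open>F\<close> lets the infinite type \<open>'u\<close> hold the copy
  \<open>M\<close>.\<close>

lemma countable_ultraproduct:
  fixes A :: "nat \<Rightarrow> ('r, 'u) struct"
  assumes inf: "infinite (UNIV :: 'u set)"
    and A: "\<And>m. A m \<in> Struct \<sigma>"
    and \<sigma>: "countable (symbols \<sigma>)"
    and U: "U \<noteq> bot" "\<And>P. eventually P U \<or> eventually (\<lambda>m. \<not> P m) U"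
    and G: "countable G" "\<And>g m. g \<in> G \<Longrightarrow> g m \<in> univ (A m)"
  shows "\<exists>F e M. G \<subseteq> F \<and> ultralimit \<sigma> U A F e M"
proof -
  have "univ (A m) \<noteq> {}" for m
    using A by (auto simp: Struct_def)
  then obtain F where F: "countable F" "G \<subseteq> F" "F \<noteq> {}" "\<And>f m. f \<in> F \<Longrightarrow> f m \<in> univ (A m)"
    and skolem: "\<And>\<phi> x v. wf_fm \<sigma> \<phi> \<Longrightarrow> range v \<subseteq> F \<Longrightarrow>
      \<exists>g\<in>F. \<forall>m. sat (A m) (\<lambda>k. v k m) (Exists x \<phi>) \<longrightarrow> sat (A m) ((\<lambda>k. v k m)(x := g m)) \<phi>"
    using countable_skolem_closure[of A \<sigma> G] \<sigma> G by metis
  obtain \<iota> :: "nat \<Rightarrow> 'u" where \<iota>: "inj \<iota>"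
    using infinite_countable_subset[OF inf] by blast
  define en where "en = from_nat_into F"
  \<comment> \<open>The least index of a sequence agreeing with \<open>f\<close> along
    \<open>U\<close> depends only on the class of \<open>f\<close>, so \<open>e\<close> identifies
    exactly the equivalent sequences.\<close>
  define ix where "ix = (\<lambda>f. LEAST k. \<forall>\<^sub>F m in U. en k m = f m)"
  define e where "e = (\<lambda>f. \<iota> (ix f))"
  have ix: "\<forall>\<^sub>F m in U. en (ix f) m = f m" if f: "f \<in> F" for f
  proof -
    obtain k where "en k = f"
      using from_nat_into_surj[OF F(1) f] by (auto simp: en_def)
    then have "\<forall>\<^sub>F m in U. en k m = f m" by simp
    then show ?thesis unfolding ix_def by (rule LeastI)
  qed
  have e_eq: "e f = e g \<longleftrightarrow> (\<forall>\<^sub>F m in U. f m = g m)" if "f \<in> F" "g \<in> F" for f g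
  proof
    assume "e f = e g"
    then have "ix f = ix g"
      using \<iota> by (simp add: e_def inj_eq)
    then show "\<forall>\<^sub>F m in U. f m = g m"
      using ix[OF that(1)] ix[OF that(2)] by (auto elim: eventually_elim2)
  next
    assume fg: "\<forall>\<^sub>F m in U. f m = g m"
    then have "(\<forall>\<^sub>F m in U. en k m = f m) \<longleftrightarrow> (\<forall>\<^sub>F m in U. en k m = g m)" for k
      by (intro eventually_subst) (auto elim: eventually_mono)
    then show "e f = e g"
      by (simp add: e_def ix_def)
  qed
  \<comment> \<open>The interpretation in \<open>M\<close> asks for some representatives of a tuple;
    this shows that the choice of representatives is immaterial.\<close>
  have e_eq_list: "\<forall>\<^sub>F m in U. map (\<lambda>f. f m) fs = map (\<lambda>g. g m) gs"
    if "set fs \<subseteq> F" "set gs \<subseteq> F" "map e fs = map e gs" for fs gs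
    using that
  proof (induction fs arbitrary: gs)
    case (Cons f fs)
    then obtain g gs' where gs: "gs = g # gs'" "e f = e g" "map e fs = map e gs'"
      by auto
    then have "\<forall>\<^sub>F m in U. map (\<lambda>f. f m) fs = map (\<lambda>g. g m) gs'" "\<forall>\<^sub>F m in U. f m = g m"
      using Cons e_eq by auto
    then show ?case
      by (auto simp: gs(1) elim: eventually_elim2)
  qed auto
  define M :: "('r, 'u) struct" where "M = \<lparr>univ = e ` F, interp = \<lambda>R. {map e fs | fs. set fs \<subseteq> F \<and>
    length fs = arity \<sigma> R \<and> (\<forall>\<^sub>F m in U. map (\<lambda>f. f m) fs \<in> interp (A m) R)}\<rparr>"
  have M: "M \<in> Struct \<sigma>"
    using F(3) by (auto simp: Struct_def M_def subset_iff)
  \<comment> \<open>Here \<open>U\<close> must be a proper ultrafilter. The steps for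
    \<open>Neg\<close>, \<open>Or\<close> and \<open>Forall\<close> rest on this.\<close>
  have not_iff: "(\<forall>\<^sub>F m in U. \<not> P m) \<longleftrightarrow> \<not> (\<forall>\<^sub>F m in U. P m)" for P
    using U(2)[of P] U(1) eventually_happens eventually_conj[of P U "\<lambda>m. \<not> P m"] by auto
  have disj_iff: "(\<forall>\<^sub>F m in U. P m \<or> Q m) \<longleftrightarrow> (\<forall>\<^sub>F m in U. P m) \<or> (\<forall>\<^sub>F m in U. Q m)" for P Q
    using not_iff[of "\<lambda>m. P m \<or> Q m"] not_iff[of P] not_iff[of Q]
    by (auto simp: eventually_conj_iff)
  \<comment> \<open>From left to right the coordinates of a witness are witnesses. From right to
    left, arbitrary coordinatewise witnesses need not form a member of \<open>F\<close>, and Skolem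
    closure supplies one that does.\<close>
  have ex_iff: "(\<exists>a\<in>univ M. sat M ((e \<circ> v)(x := a)) \<phi>) \<longleftrightarrow>
      (\<forall>\<^sub>F m in U. \<exists>a\<in>univ (A m). sat (A m) ((\<lambda>k. v k m)(x := a)) \<phi>)"
    if \<phi>: "wf_fm \<sigma> \<phi>" and v: "range v \<subseteq> F"
      and IH: "\<And>v. range v \<subseteq> F \<Longrightarrow>
        sat M (e \<circ> v) \<phi> \<longleftrightarrow> (\<forall>\<^sub>F m in U. sat (A m) (\<lambda>k. v k m) \<phi>)"
    for \<phi> x v
  proof -
    have upd: "(\<lambda>k. (v(x := f)) k m) = (\<lambda>k. v k m)(x := f m)" for f m
      by auto
    have IH': "sat M ((e \<circ> v)(x := e f)) \<phi> \<longleftrightarrow>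
        (\<forall>\<^sub>F m in U. sat (A m) ((\<lambda>k. v k m)(x := f m)) \<phi>)" if "f \<in> F" for f
      using IH[of "v(x := f)"] v that unfolding upd fun_upd_comp by auto
    show ?thesis (is "?l \<longleftrightarrow> ?r")
    proof
      assume ?l
      then obtain f where "f \<in> F" "sat M ((e \<circ> v)(x := e f)) \<phi>"
        by (auto simp: M_def)
      then show ?r
        using IH' F(4) by (auto elim!: eventually_mono)
    next
      assume r: ?r
      obtain g where g: "g \<in> F" "\<And>m. sat (A m) (\<lambda>k. v k m) (Exists x \<phi>) \<Longrightarrow>
          sat (A m) ((\<lambda>k. v k m)(x := g m)) \<phi>"
        using skolem[OF \<phi> v] by blast
      have "\<forall>\<^sub>F m in U. sat (A m) ((\<lambda>k. v k m)(x := g m)) \<phi>"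
        using r by (rule eventually_mono) (use g(2) in auto)
      then show ?l
        using IH' g(1) by (auto simp: M_def)
    qed
  qed
  have "sat M (e \<circ> v) \<phi> \<longleftrightarrow> (\<forall>\<^sub>F m in U. sat (A m) (\<lambda>k. v k m) \<phi>)"
    if "wf_fm \<sigma> \<phi>" "range v \<subseteq> F" for \<phi> v
    using that
  proof (induction \<phi> arbitrary: v)
    case Bot
    then show ?case using U(1) by (simp add: trivial_limit_def)
  next
    case (Eq x y)
    then have "v x \<in> F" "v y \<in> F" by auto
    then show ?case by (simp add: e_eq)
  next
    case (Rel R xs)
    have *: "set (map v xs) \<subseteq> F" using Rel.prems by auto
    have "map (e \<circ> v) xs \<in> interp M R \<longleftrightarrow> (\<forall>\<^sub>F m in U. map (\<lambda>f. f m) (map v xs) \<in> interp (A m) R)"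
    proof
      assume "map (e \<circ> v) xs \<in> interp M R"
      then obtain fs where fs: "map e (map v xs) = map e fs" "set fs \<subseteq> F"
        "\<forall>\<^sub>F m in U. map (\<lambda>f. f m) fs \<in> interp (A m) R"
        by (auto simp: M_def)
      show "\<forall>\<^sub>F m in U. map (\<lambda>f. f m) (map v xs) \<in> interp (A m) R"
        using e_eq_list[OF * fs(2,1)] fs(3) by (rule eventually_elim2) simp
    next
      assume "\<forall>\<^sub>F m in U. map (\<lambda>f. f m) (map v xs) \<in> interp (A m) R"
      then show "map (e \<circ> v) xs \<in> interp M R"
        using Rel.prems * by (auto simp: M_def intro!: exI[of _ "map v xs"])
    qed
    then show ?case by (simp add: comp_def)
  next
    case (Neg \<phi>)
    then show ?case by (simp add: not_iff)
  next
    case (And \<phi> \<psi>)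
    then show ?case by (simp add: eventually_conj_iff)
  next
    case (Or \<phi> \<psi>)
    then show ?case by (simp add: disj_iff)
  next
    case (Exists x \<phi>)
    have "(\<exists>a\<in>univ M. sat M ((e \<circ> v)(x := a)) \<phi>) \<longleftrightarrow>
        (\<forall>\<^sub>F m in U. \<exists>a\<in>univ (A m). sat (A m) ((\<lambda>k. v k m)(x := a)) \<phi>)"
      using Exists.prems by (intro ex_iff Exists.IH) simp_all
    then show ?case by (simp add: comp_def)
  next
    case (Forall x \<phi>)
    \<comment> \<open>The universal quantifier is treated as the dual of the existential one applied
      to \<open>Neg \<phi>\<close>.\<close>
    have "(\<exists>a\<in>univ M. sat M ((e \<circ> v)(x := a)) (Neg \<phi>)) \<longleftrightarrow>
        (\<forall>\<^sub>F m in U. \<exists>a\<in>univ (A m). sat (A m) ((\<lambda>k. v k m)(x := a)) (Neg \<phi>))"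
      using Forall by (intro ex_iff) (simp_all add: not_iff comp_def)
    then show ?case
      using not_iff[of "\<lambda>m. \<forall>a\<in>univ (A m). sat (A m) ((\<lambda>k. v k m)(x := a)) \<phi>"]
      by (auto simp: comp_def)
  qed auto
  moreover have "univ M = e ` F"
    by (simp add: M_def)
  ultimately have "ultralimit \<sigma> U A F e M"
    using F M by (simp add: ultralimit_def)
  with F(2) show ?thesis by blast
qed

lemma ultralimit_models:
  assumes M: "ultralimit \<sigma> U A F e M" and \<phi>: "\<phi> \<in> FO \<sigma>"
  shows "M \<Turnstile> \<phi> \<longleftrightarrow> (\<forall>\<^sub>F m in U. A m \<Turnstile> \<phi>)"
proof -
  obtain f where f: "f \<in> F"
    using M by (auto simp: ultralimit_def)
  have "A m \<Turnstile> \<phi> \<longleftrightarrow> sat (A m) (\<lambda>k. f m) \<phi>" for m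
    using \<phi> M f by (intro models_iff_sat) (auto simp: FO_def ultralimit_def)
  moreover have "M \<Turnstile> \<phi> \<longleftrightarrow> sat M (e \<circ> (\<lambda>k. f)) \<phi>"
    using \<phi> f M by (intro models_iff_sat) (auto simp: FO_def ultralimit_def)
  moreover have "sat M (e \<circ> (\<lambda>k. f)) \<phi> \<longleftrightarrow> (\<forall>\<^sub>F m in U. sat (A m) (\<lambda>k. f m) \<phi>)"
  proof -
    have "wf_fm \<sigma> \<phi>" "range (\<lambda>k::nat. f) \<subseteq> F"
      using \<phi> f by (auto simp: FO_def)
    then show ?thesis
      using M unfolding ultralimit_def by blast
  qed
  ultimately show ?thesis by simp
qed

text \<open>A sentence true in \<open>M\<close> holds for \<open>U\<close>-many \<open>m\<close>,
  hence in at least one finite \<open>A m\<close>, because \<open>U\<close> is proper.\<close>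

lemma FMP_if_limit_of_finite:
  fixes M :: "('r, 'u) struct" and A :: "nat \<Rightarrow> ('r, 'u) struct"
  assumes "M \<in> Struct \<sigma>" "U \<noteq> bot"
    and "\<And>m. A m \<in> Struct \<sigma>" "\<And>m. finite (univ (A m))"
    and "\<forall>\<phi>\<in>FO \<sigma>. M \<Turnstile> \<phi> \<longleftrightarrow> (\<forall>\<^sub>F m in U. A m \<Turnstile> \<phi>)"
  shows "M \<in> FMP \<sigma>"
  using assms eventually_happens'[OF assms(2)] unfolding FMP_def by blast

section \<open>The preservation theorem\<close>

text \<open>Enumerate the elements of \<open>M\<close>. Each finite part of its positive diagram is
  an existential positive condition, so it passes from \<open>A m\<close> to \<open>B m\<close>
  along \<open>U\<close>. A diagonal choice realises all parts together by sequences
  \<open>g k\<close>, and \<open>N\<close> is built to contain their classes.\<close>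

lemma ultralimit_hom:
  fixes A B :: "nat \<Rightarrow> ('r, 'u) struct"
  assumes inf: "infinite (UNIV :: 'u set)"
    and \<sigma>: "finite (symbols \<sigma>)"
    and A: "\<And>m. A m \<in> Struct \<sigma>" and B: "\<And>m. B m \<in> Struct \<sigma>"
    and U: "U \<le> sequentially" "U \<noteq> bot" "\<And>P. eventually P U \<or> eventually (\<lambda>m. \<not> P m) U"
    and EP: "\<And>\<psi>. \<psi> \<in> EPFO \<sigma> \<Longrightarrow> \<forall>\<^sub>F m in U. A m \<Turnstile> \<psi> \<longrightarrow> B m \<Turnstile> \<psi>"
  shows "\<exists>M\<in>Struct \<sigma> :: ('r, 'u) struct set. \<exists>N\<in>Struct \<sigma>. hom_le \<sigma> M N \<and>
    (\<forall>\<phi>\<in>FO \<sigma>. M \<Turnstile> \<phi> \<longleftrightarrow> (\<forall>\<^sub>F m in U. A m \<Turnstile> \<phi>)) \<and>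
    (\<forall>\<phi>\<in>FO \<sigma>. N \<Turnstile> \<phi> \<longleftrightarrow> (\<forall>\<^sub>F m in U. B m \<Turnstile> \<phi>))"
proof -
  note csig = countable_finite[OF \<sigma>]
  obtain F M e where lim_M: "ultralimit \<sigma> U A F e M"
    using countable_ultraproduct[of A \<sigma> U "{}"] inf A csig U(2,3) by auto
  then have F: "countable F" "F \<noteq> {}" "\<And>f m. f \<in> F \<Longrightarrow> f m \<in> univ (A m)"
    and M: "M \<in> Struct \<sigma>" "univ M = e ` F"
    and los_M: "\<And>\<phi> v. wf_fm \<sigma> \<phi> \<Longrightarrow> range v \<subseteq> F \<Longrightarrow>
      sat M (e \<circ> v) \<phi> \<longleftrightarrow> (\<forall>\<^sub>F m in U. sat (A m) (\<lambda>k. v k m) \<phi>)"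
    by (simp_all add: ultralimit_def)
  define f where "f = from_nat_into F"
  have rf: "range f = F"
    using F by (simp add: f_def)
  then have fA: "f k m \<in> univ (A m)" for k m
    using F(3) by blast
  \<comment> \<open>\<open>\<Delta> n\<close> is the part of the positive diagram of
    \<open>M\<close> about the elements named by the first \<open>n\<close> sequences; it is finite
    because the signature is.\<close>
  define \<Delta> where "\<Delta> = (\<lambda>n. {(R, ks). R \<in> symbols \<sigma> \<and> length ks = arity \<sigma> R \<and> set ks \<subseteq> {..<n} \<and>
    (\<forall>\<^sub>F m in U. map (\<lambda>k. f k m) ks \<in> interp (A m) R)})"
  have fin: "finite (\<Delta> n)" for n
  proof (rule finite_subset)
    show "\<Delta> n \<subseteq> Sigma (symbols \<sigma>) (\<lambda>R. {ks. set ks \<subseteq> {..<n} \<and> length ks = arity \<sigma> R})"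
      by (auto simp: \<Delta>_def)
    show "finite (Sigma (symbols \<sigma>) (\<lambda>R. {ks. set ks \<subseteq> {..<n} \<and> length ks = arity \<sigma> R}))"
      using \<sigma> by (intro finite_SigmaI finite_lists_length_eq) auto
  qed
  define P where "P = (\<lambda>n m w. range w \<subseteq> univ (B m) \<and> (\<forall>(R, ks)\<in>\<Delta> n. map w ks \<in> interp (B m) R))"
  have evP: "\<forall>\<^sub>F m in U. \<exists>w. P n m w" for n
  proof -
    have "\<exists>\<psi>\<in>EPFO \<sigma>. \<forall>C\<in>Struct \<sigma> :: ('r, 'u) struct set. C \<Turnstile> \<psi> \<longleftrightarrow>
        (\<exists>w. range w \<subseteq> univ C \<and> (\<forall>(R, ks)\<in>\<Delta> n. map w ks \<in> interp C R))"
      by (rule atoms_EPFO[OF fin]) (simp add: \<Delta>_def)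
    then obtain \<psi> where \<psi>: "\<psi> \<in> EPFO \<sigma>"
      "\<forall>C\<in>Struct \<sigma> :: ('r, 'u) struct set. C \<Turnstile> \<psi> \<longleftrightarrow>
        (\<exists>w. range w \<subseteq> univ C \<and> (\<forall>(R, ks)\<in>\<Delta> n. map w ks \<in> interp C R))"
      by (rule bexE)
    have "\<forall>\<^sub>F m in U. \<forall>(R, ks)\<in>\<Delta> n. map (\<lambda>k. f k m) ks \<in> interp (A m) R"
      using fin by (intro eventually_ball_finite) (auto simp: \<Delta>_def)
    \<comment> \<open>For \<open>U\<close>-many \<open>m\<close> the values \<open>f k m\<close>
      realise \<open>\<Delta> n\<close> in \<open>A m\<close>, so \<open>\<psi>\<close> holds there
      and is transferred to \<open>B m\<close>.\<close>
    with EP[OF \<psi>(1)] show ?thesis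
    proof (rule eventually_elim2)
      fix m assume "A m \<Turnstile> \<psi> \<longrightarrow> B m \<Turnstile> \<psi>"
        "\<forall>(R, ks)\<in>\<Delta> n. map (\<lambda>k. f k m) ks \<in> interp (A m) R"
      moreover have "range (\<lambda>k. f k m) \<subseteq> univ (A m)"
        using fA by auto
      ultimately show "\<exists>w. P n m w"
        using bspec[OF \<psi>(2) A[of m]] bspec[OF \<psi>(2) B[of m]] unfolding P_def by blast
    qed
  qed
  have mono: "P n m w" if "P n' m w" "n \<le> n'" for n n' m w
    using that by (fastforce simp: P_def \<Delta>_def)
  have "\<exists>w. range w \<subseteq> univ (B m) \<and> (\<forall>n\<le>m. (\<exists>w. P n m w) \<longrightarrow> P n m w)" for m
  proof (cases "\<exists>n\<le>m. \<exists>w. P n m w")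
    case True
    \<comment> \<open>The bound \<open>m\<close> guarantees a largest satisfiable stage, and by
      \<open>mono\<close> an assignment for it serves every lower stage.\<close>
    define n where "n = (GREATEST n. n \<le> m \<and> (\<exists>w. P n m w))"
    have "n \<le> m \<and> (\<exists>w. P n m w)"
      unfolding n_def by (rule GreatestI_ex_nat[of _ m]) (use True in auto)
    then obtain w where w: "P n m w" by blast
    have max: "n' \<le> n" if "n' \<le> m" "\<exists>w. P n' m w" for n'
      unfolding n_def by (rule Greatest_le_nat[of _ _ m]) (use that in auto)
    have "P n' m w" if "n' \<le> m" "\<exists>w. P n' m w" for n'
      using w max[OF that] by (rule mono)
    moreover have "range w \<subseteq> univ (B m)"
      using w by (simp add: P_def)
    ultimately show ?thesis by blast
  next
    case False
    obtain b where "b \<in> univ (B m)"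
      using B[of m] by (auto simp: Struct_def)
    then show ?thesis
      using False by (intro exI[of _ "\<lambda>_. b"]) auto
  qed
  then obtain w where w: "\<And>m. range (w m) \<subseteq> univ (B m)"
    and Pw: "\<And>m n. n \<le> m \<Longrightarrow> \<exists>w. P n m w \<Longrightarrow> P n m (w m)"
    by metis
  \<comment> \<open>Saturation by a diagonal choice: in coordinate \<open>m\<close>, \<open>w m\<close> satisfies as many of the stages
    \<open>\<Delta> n\<close>, \<open>n \<le> m\<close>, of the positive diagram of \<open>M\<close> as can be satisfied there.\<close>
  define g where "g = (\<lambda>k m. w m k)"
  have g: "\<forall>\<^sub>F m in U. map (\<lambda>k. g k m) ks \<in> interp (B m) R"
    if R: "R \<in> symbols \<sigma>" "length ks = arity \<sigma> R"
      and ev: "\<forall>\<^sub>F m in U. map (\<lambda>k. f k m) ks \<in> interp (A m) R" for R ks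
  proof -
    obtain n where "set ks \<subseteq> {..<n}"
      using finite_nat_bounded[of "set ks"] by auto
    then have \<Delta>: "(R, ks) \<in> \<Delta> n"
      using R ev by (auto simp: \<Delta>_def)
    \<comment> \<open>Coordinate \<open>m\<close> handles only the stages up to \<open>m\<close>;
      since \<open>U\<close> refines \<open>sequentially\<close>, this excludes a negligible set of
      coordinates.\<close>
    have "\<forall>\<^sub>F m in U. n \<le> m"
      using U(1) eventually_ge_at_top by (rule filter_leD)
    then show ?thesis
      using evP[of n]
    proof (rule eventually_elim2)
      fix m assume "n \<le> m" "\<exists>w. P n m w"
      then have "P n m (w m)" by (rule Pw)
      then show "map (\<lambda>k. g k m) ks \<in> interp (B m) R"
        using \<Delta> by (auto simp: P_def g_def)
    qed
  qed
  have "countable (range g)" by simp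
  moreover have "h m \<in> univ (B m)" if "h \<in> range g" for h m
    using that w by (auto simp: g_def)
  ultimately obtain F' N e' where F': "range g \<subseteq> F'" and lim_N: "ultralimit \<sigma> U B F' e' N"
    using countable_ultraproduct[of B \<sigma> U "range g"] inf B csig U(2,3) by auto
  then have N: "N \<in> Struct \<sigma>" "univ N = e' ` F'"
    and los_N: "\<And>\<phi> v. wf_fm \<sigma> \<phi> \<Longrightarrow> range v \<subseteq> F' \<Longrightarrow>
      sat N (e' \<circ> v) \<phi> \<longleftrightarrow> (\<forall>\<^sub>F m in U. sat (B m) (\<lambda>k. v k m) \<phi>)"
    by (simp_all add: ultralimit_def)
  \<comment> \<open>The enumeration may name an element repeatedly, and the stages
    \<open>\<Delta> n\<close> record no equalities. Fixing one index per element makes the map well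
    defined.\<close>
  have "\<forall>a\<in>univ M. \<exists>k. e (f k) = a"
    by (auto simp: M(2) rf[symmetric])
  then obtain ix where ix: "\<And>a. a \<in> univ M \<Longrightarrow> e (f (ix a)) = a"
    by metis
  have "homomorphism \<sigma> M N (\<lambda>a. e' (g (ix a)))"
    unfolding homomorphism_def
  proof (intro conjI ballI)
    show "(\<lambda>a. e' (g (ix a))) ` univ M \<subseteq> univ N"
      using F' N(2) by auto
  next
    fix R xs assume R: "R \<in> symbols \<sigma>" and xs: "xs \<in> interp M R"
    then have len: "length xs = arity \<sigma> R" and "set xs \<subseteq> univ M"
      using M(1) by (auto simp: Struct_def)
    then have "map (e \<circ> f) (map ix xs) = xs"
      using ix by (auto intro!: map_idI)
    then have "sat M (e \<circ> f) (Rel R (map ix xs))"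
      using xs by simp
    then have "\<forall>\<^sub>F m in U. sat (A m) (\<lambda>k. f k m) (Rel R (map ix xs))"
      using los_M[of "Rel R (map ix xs)" f] R len rf by simp
    then have "\<forall>\<^sub>F m in U. sat (B m) (\<lambda>k. g k m) (Rel R (map ix xs))"
      using g[of R "map ix xs"] R len by simp
    then have "sat N (e' \<circ> g) (Rel R (map ix xs))"
      using los_N[of "Rel R (map ix xs)" g] R len F' by simp
    then show "map (\<lambda>a. e' (g (ix a))) xs \<in> interp N R"
      by (simp add: comp_def)
  qed
  then have "hom_le \<sigma> M N"
    by (auto simp: hom_le_def)
  then show ?thesis
    using M(1) N(1) ultralimit_models[OF lim_M] ultralimit_models[OF lim_N] by blast
qed

text \<open>Without such a pair, \<open>\<phi>\<close> agrees on finite structures with a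
  disjunction of conjunctions from \<open>T\<close>. The finite model property carries this
  equivalence over to all of \<open>FMP \<sigma>\<close>, against \<open>no\<close>.\<close>

lemma separating_finite_structures:
  assumes \<phi>: "\<phi> \<in> FO \<sigma>"
    and no: "\<And>\<psi>. \<psi> \<in> EPFO \<sigma> \<Longrightarrow> \<not> (\<forall>A\<in>FMP \<sigma> :: ('r, 'u) struct set. A \<Turnstile> \<phi> \<longleftrightarrow> A \<Turnstile> \<psi>)"
    and T: "finite T" "T \<subseteq> EPFO \<sigma>"
  obtains A B :: "('r, 'u) struct" where "A \<in> Struct \<sigma>" "B \<in> Struct \<sigma>"
    "finite (univ A)" "finite (univ B)" "A \<Turnstile> \<phi>" "\<not> B \<Turnstile> \<phi>" "\<And>\<psi>. \<psi> \<in> T \<Longrightarrow> A \<Turnstile> \<psi> \<Longrightarrow> B \<Turnstile> \<psi>"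
proof (rule ccontr)
  note separated = that
  assume "\<not> thesis"
  then have sep: "B \<Turnstile> \<phi>" if "A \<in> Struct \<sigma>" "B \<in> Struct \<sigma>" "finite (univ A)" "finite (univ B)"
    "A \<Turnstile> \<phi>" "\<And>\<psi>. \<psi> \<in> T \<Longrightarrow> A \<Turnstile> \<psi> \<Longrightarrow> B \<Turnstile> \<psi>" for A B :: "('r, 'u) struct"
    using that separated by blast
  have "\<exists>\<psi>\<in>EPFO \<sigma>. \<forall>A\<in>Struct \<sigma> :: ('r, 'u) struct set. A \<Turnstile> \<psi> \<longleftrightarrow> (\<forall>\<chi>\<in>S. A \<Turnstile> \<chi>)" if "S \<subseteq> T" for S
    using that T by (intro finite_conj_EPFO) (auto intro: finite_subset)
  then obtain c where c: "\<And>S. S \<subseteq> T \<Longrightarrow> c S \<in> EPFO \<sigma>"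
    "\<And>S (A::('r, 'u) struct). S \<subseteq> T \<Longrightarrow> A \<in> Struct \<sigma> \<Longrightarrow> A \<Turnstile> c S \<longleftrightarrow> (\<forall>\<chi>\<in>S. A \<Turnstile> \<chi>)"
    by metis
  \<comment> \<open>These are the \<open>T\<close>-types of the finite models of
    \<open>\<phi>\<close>. There may be infinitely many models, but only finitely many types, as
    they are subsets of \<open>T\<close>.\<close>
  define \<T> where "\<T> = {{\<psi>\<in>T. A \<Turnstile> \<psi>} | A :: ('r, 'u) struct. A \<in> Struct \<sigma> \<and> finite (univ A) \<and> A \<Turnstile> \<phi>}"
  have "\<T> \<subseteq> Pow T"
    by (auto simp: \<T>_def)
  then have "finite (c ` \<T>)" "c ` \<T> \<subseteq> EPFO \<sigma>"
    using T c(1) by (auto intro: finite_subset)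
  then have "\<exists>\<psi>\<in>EPFO \<sigma>. \<forall>A\<in>Struct \<sigma> :: ('r, 'u) struct set. A \<Turnstile> \<psi> \<longleftrightarrow> (\<exists>\<chi>\<in>c ` \<T>. A \<Turnstile> \<chi>)"
    by (rule finite_disj_EPFO)
  then obtain \<psi> where \<psi>: "\<psi> \<in> EPFO \<sigma>"
    "\<forall>A\<in>Struct \<sigma> :: ('r, 'u) struct set. A \<Turnstile> \<psi> \<longleftrightarrow> (\<exists>\<chi>\<in>c ` \<T>. A \<Turnstile> \<chi>)"
    by (rule bexE)
  have fin: "B \<Turnstile> \<phi> \<longleftrightarrow> B \<Turnstile> \<psi>" if B: "B \<in> Struct \<sigma>" "finite (univ B)" for B :: "('r, 'u) struct"
  proof
    assume "B \<Turnstile> \<phi>"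
    then have "{\<psi>\<in>T. B \<Turnstile> \<psi>} \<in> \<T>"
      using B by (auto simp: \<T>_def)
    moreover have "B \<Turnstile> c {\<psi>\<in>T. B \<Turnstile> \<psi>}"
      using B c(2) by auto
    ultimately show "B \<Turnstile> \<psi>"
      using bspec[OF \<psi>(2) B(1)] by blast
  next
    assume "B \<Turnstile> \<psi>"
    then obtain S where S: "S \<in> \<T>" "B \<Turnstile> c S"
      using bspec[OF \<psi>(2) B(1)] by auto
    then obtain A :: "('r, 'u) struct" where A: "S = {\<psi>\<in>T. A \<Turnstile> \<psi>}" "A \<in> Struct \<sigma>" "finite (univ A)" "A \<Turnstile> \<phi>"
      by (auto simp: \<T>_def)
    then have "\<forall>\<chi>\<in>S. B \<Turnstile> \<chi>"
      using c(2)[of S B] S B by auto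
    then show "B \<Turnstile> \<phi>"
      using sep[of A B] A B by auto
  qed
  have \<psi>FO: "\<psi> \<in> FO \<sigma>"
    using \<psi> by (simp add: EPFO_def)
  \<comment> \<open>The exclusive disjunction of \<open>\<phi>\<close> and \<open>\<psi>\<close>: a
    structure in \<open>FMP \<sigma>\<close> where they differ satisfies it, so some finite
    structure does too.\<close>
  define \<theta> where "\<theta> = Or (And \<phi> (Neg \<psi>)) (And (Neg \<phi>) \<psi>)"
  have \<theta>: "\<theta> \<in> FO \<sigma>" "Neg \<phi> \<in> FO \<sigma>" "Neg \<psi> \<in> FO \<sigma>" "And \<phi> (Neg \<psi>) \<in> FO \<sigma>" "And (Neg \<phi>) \<psi> \<in> FO \<sigma>"
    using \<phi> \<psi>FO by (auto simp: \<theta>_def FO_def)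
  have \<theta>_iff: "A \<Turnstile> \<theta> \<longleftrightarrow> \<not> (A \<Turnstile> \<phi> \<longleftrightarrow> A \<Turnstile> \<psi>)" if "A \<in> Struct \<sigma>" for A :: "('r, 'u) struct"
    using that \<theta> \<phi> \<psi>FO by (auto simp: \<theta>_def models_connectives[where \<sigma> = \<sigma>])
  obtain A :: "('r, 'u) struct" where A: "A \<in> FMP \<sigma>" "\<not> (A \<Turnstile> \<phi> \<longleftrightarrow> A \<Turnstile> \<psi>)"
    using no[OF \<psi>(1)] by blast
  then have "A \<Turnstile> \<theta>"
    using \<theta>_iff by (simp add: FMP_def)
  then obtain B :: "('r, 'u) struct" where "B \<in> Struct \<sigma>" "finite (univ B)" "B \<Turnstile> \<theta>"
    using A(1) \<theta>(1) unfolding FMP_def by blast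
  then show False
    using \<theta>_iff fin by blast
qed

theorem corollary6p3:
  fixes \<sigma> :: "'r signature"
  assumes "finite (symbols \<sigma>)"
    and "infinite (UNIV :: 'u set)"
  shows "preservation_property \<sigma> (FMP \<sigma> :: ('r, 'u) struct set)
           (alexandroff_topology (FMP \<sigma>) (hom_le \<sigma>)) (EPFO \<sigma>)"
  unfolding preservation_property_def openin_alexandroff_topology
proof (intro conjI ballI impI)
  fix \<psi> assume "\<psi> \<in> EPFO \<sigma>"
  then show "upwards_closed_in (FMP \<sigma>) (hom_le \<sigma>) {A \<in> FMP \<sigma> :: ('r, 'u) struct set. A \<Turnstile> \<psi>}"
    using EPFO_hom_le by (fastforce simp: upwards_closed_in_def FMP_def)
next
  fix \<phi> assume \<phi>: "\<phi> \<in> FO \<sigma>"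
    and up: "upwards_closed_in (FMP \<sigma>) (hom_le \<sigma>) {A \<in> FMP \<sigma> :: ('r, 'u) struct set. A \<Turnstile> \<phi>}"
  show "\<exists>\<psi>\<in>EPFO \<sigma>. \<forall>A\<in>FMP \<sigma> :: ('r, 'u) struct set. A \<Turnstile> \<phi> \<longleftrightarrow> A \<Turnstile> \<psi>"
  proof (rule ccontr)
    assume "\<not> ?thesis"
    then have no: "\<not> (\<forall>A\<in>FMP \<sigma> :: ('r, 'u) struct set. A \<Turnstile> \<phi> \<longleftrightarrow> A \<Turnstile> \<psi>)" if "\<psi> \<in> EPFO \<sigma>" for \<psi>
      using that by blast
    have "Top \<in> EPFO \<sigma>"
      by (simp add: EPFO_def FO_def)
    then have ne: "EPFO \<sigma> \<noteq> {}" by blast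
    have count: "countable (EPFO \<sigma>)"
      using countable_wf_fm[OF countable_finite[OF assms(1)]]
      by (rule countable_subset[rotated]) (auto simp: EPFO_def FO_def)
    \<comment> \<open>These finite sets increase and exhaust \<open>EPFO \<sigma>\<close>, so a
      given sentence lies in \<open>T m\<close> for all large \<open>m\<close>.\<close>
    define T where "T = (\<lambda>n. from_nat_into (EPFO \<sigma>) ` {..n})"
    have "\<exists>(A :: ('r, 'u) struct) (B :: ('r, 'u) struct). A \<in> Struct \<sigma> \<and> B \<in> Struct \<sigma> \<and>
        finite (univ A) \<and> finite (univ B) \<and> A \<Turnstile> \<phi> \<and> \<not> B \<Turnstile> \<phi> \<and> (\<forall>\<psi>\<in>T n. A \<Turnstile> \<psi> \<longrightarrow> B \<Turnstile> \<psi>)" for n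
    proof -
      have "finite (T n)" "T n \<subseteq> EPFO \<sigma>"
        using from_nat_into[OF ne] by (auto simp: T_def)
      from separating_finite_structures[OF \<phi> no this] show ?thesis by metis
    qed
    then obtain A B :: "nat \<Rightarrow> ('r, 'u) struct" where
      AB: "\<And>n. A n \<in> Struct \<sigma>" "\<And>n. B n \<in> Struct \<sigma>" "\<And>n. finite (univ (A n))"
        "\<And>n. finite (univ (B n))" "\<And>n. A n \<Turnstile> \<phi>" "\<And>n. \<not> B n \<Turnstile> \<phi>"
        "\<And>n \<psi>. \<psi> \<in> T n \<Longrightarrow> A n \<Turnstile> \<psi> \<Longrightarrow> B n \<Turnstile> \<psi>"
      by metis
    obtain U :: "nat filter" where U: "U \<le> sequentially" "U \<noteq> bot"
      "\<And>P. eventually P U \<or> eventually (\<lambda>m. \<not> P m) U"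
      using ultrafilter_extension[of sequentially] by auto
    have "\<forall>\<^sub>F m in U. A m \<Turnstile> \<psi> \<longrightarrow> B m \<Turnstile> \<psi>" if \<psi>: "\<psi> \<in> EPFO \<sigma>" for \<psi>
    proof -
      obtain n where n: "from_nat_into (EPFO \<sigma>) n = \<psi>"
        using from_nat_into_surj[OF count \<psi>] by blast
      have "\<forall>\<^sub>F m in U. n \<le> m"
        using U(1) eventually_ge_at_top by (rule filter_leD)
      then show ?thesis
      proof (rule eventually_mono)
        fix m assume "n \<le> m"
        then have "\<psi> \<in> T m"
          using n by (auto simp: T_def)
        then show "A m \<Turnstile> \<psi> \<longrightarrow> B m \<Turnstile> \<psi>"
          using AB(7) by blast
      qed
    qed
    then have "\<exists>M\<in>Struct \<sigma> :: ('r, 'u) struct set. \<exists>N\<in>Struct \<sigma>. hom_le \<sigma> M N \<and>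
        (\<forall>\<phi>\<in>FO \<sigma>. M \<Turnstile> \<phi> \<longleftrightarrow> (\<forall>\<^sub>F m in U. A m \<Turnstile> \<phi>)) \<and>
        (\<forall>\<phi>\<in>FO \<sigma>. N \<Turnstile> \<phi> \<longleftrightarrow> (\<forall>\<^sub>F m in U. B m \<Turnstile> \<phi>))"
      by (rule ultralimit_hom[OF assms(2,1) AB(1,2) U])
    then obtain M N :: "('r, 'u) struct" where MN: "M \<in> Struct \<sigma>" "N \<in> Struct \<sigma>" "hom_le \<sigma> M N"
      and M: "\<forall>\<phi>\<in>FO \<sigma>. M \<Turnstile> \<phi> \<longleftrightarrow> (\<forall>\<^sub>F m in U. A m \<Turnstile> \<phi>)"
      and N: "\<forall>\<phi>\<in>FO \<sigma>. N \<Turnstile> \<phi> \<longleftrightarrow> (\<forall>\<^sub>F m in U. B m \<Turnstile> \<phi>)"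
      by (elim bexE conjE)
    \<comment> \<open>Both limits stay inside \<open>FMP \<sigma>\<close>, where the assumed upward
      closure applies to the homomorphism from \<open>M\<close> to \<open>N\<close>.\<close>
    have "M \<in> FMP \<sigma>" "N \<in> FMP \<sigma>"
      using FMP_if_limit_of_finite[OF MN(1) U(2) AB(1,3) M] FMP_if_limit_of_finite[OF MN(2) U(2) AB(2,4) N]
      by auto
    moreover have "M \<Turnstile> \<phi>" "\<not> N \<Turnstile> \<phi>"
      using bspec[OF M \<phi>] bspec[OF N \<phi>] AB(5,6) U(2) by (auto simp: trivial_limit_def)
    ultimately show False
      using up MN(3) by (auto simp: upwards_closed_in_def)
  qed
qed

end
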